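(* The existence of convex polyhedral inductive separating invariants is undecidable even for systems with only one control state in addition to the "bad" one, when polynomial (nonlinear) conditions are allowed on the transitions. Precisely, the following decision problem is undecidable. Input: an integer $n \ge 0$; the set of control states $C = \{c_i, c_f\}$ with $c_i \ne c_f$; a point $x_0 \in \mathbb{Q}^n$; and, for all $j,k \in C$, a transition relation $\tau_{j,k} \subseteq \mathbb{Q}^n \times \mathbb{Q}^n$ given by linear arithmetic assignments with polynomial guards. Question: do there exist convex polyhedra $I(c_i), I(c_f)$ in $\mathbb{Q}^n$ such that $x_0 \in I(c_i)$, $I(c_f) = \emptyset$, and $$\forall j,k \in C\ \ \forall x,x' \in \mathbb{Q}^n\quad x \in I(j) \land (x,x') \in \tau_{j,k} \Rightarrow x' \in I(k)\,?$$
   Context: A convex polyhedron in $\mathbb{Q}^n$ is the solution set in $\mathbb{Q}^n$ of a finite system of linear (affine) non-strict inequalities and equalities with rational coefficients; it may be empty or unbounded. No bound is imposed on the number of constraints. A transition relation with linear arithmetic assignments and polynomial guards is a relation defined by a finite (possibly empty) disjunction of formulas of the form $g(x) \land x' = Ax + b$, where $A$ is a rational $n\times n$ matrix, $b \in \mathbb{Q}^n$, and $g$ is a finite conjunction of constraints $p(x) \bowtie 0$ with $p \in \mathbb{Q}[x_1,\dots,x_n]$ and $\bowtie\ \in \{=,<,\le,>,\ge\}$. Undecidable means that there is no algorithm (Turing machine) which, on every input, halts and correctly answers the question. *)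

theory Defs
  imports Jordan_Normal_Form.Matrix
begin

section \<open>Convex polyhedra in rational space\<close>

definition convex_polyhedron :: "nat \<Rightarrow> rat vec set \<Rightarrow> bool" where
  "convex_polyhedron n P \<longleftrightarrow>
     (\<exists>ineqs eqs. finite ineqs \<and> finite eqs \<and>
        ineqs \<subseteq> carrier_vec n \<times> UNIV \<and> eqs \<subseteq> carrier_vec n \<times> UNIV \<and>
        P = {x \<in> carrier_vec n.
               (\<forall>(a, \<beta>) \<in> ineqs. a \<bullet> x \<le> \<beta>) \<and> (\<forall>(a, \<beta>) \<in> eqs. a \<bullet> x = \<beta>)})"


section \<open>Systems with affine assignments and polynomial guards\<close>

text \<open>A polynomial in n variables is presented as a list of terms; the term (c, es), where es has
  length n, stands for c times the product of the powers x_i ^ (es ! i).\<close>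

type_synonym polynomial = "(rat \<times> nat list) list"

definition wf_polynomial :: "nat \<Rightarrow> polynomial \<Rightarrow> bool" where
  "wf_polynomial n p \<longleftrightarrow> (\<forall>(c, es) \<in> set p. length es = n)"

definition eval_polynomial :: "nat \<Rightarrow> polynomial \<Rightarrow> rat vec \<Rightarrow> rat" where
  "eval_polynomial n p x = (\<Sum>(c, es)\<leftarrow>p. c * (\<Prod>i<n. (x $ i) ^ (es ! i)))"

datatype comparison = EQ | LT | LE | GT | GE

fun compare_zero :: "comparison \<Rightarrow> rat \<Rightarrow> bool" where
  "compare_zero EQ v \<longleftrightarrow> v = 0"
| "compare_zero LT v \<longleftrightarrow> v < 0"
| "compare_zero LE v \<longleftrightarrow> v \<le> 0"
| "compare_zero GT v \<longleftrightarrow> v > 0"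
| "compare_zero GE v \<longleftrightarrow> v \<ge> 0"

type_synonym guard = "(polynomial \<times> comparison) list"

definition wf_guard :: "nat \<Rightarrow> guard \<Rightarrow> bool" where
  "wf_guard n g \<longleftrightarrow> (\<forall>(p, c) \<in> set g. wf_polynomial n p)"

definition holds_guard :: "nat \<Rightarrow> guard \<Rightarrow> rat vec \<Rightarrow> bool" where
  "holds_guard n g x \<longleftrightarrow> (\<forall>(p, c) \<in> set g. compare_zero c (eval_polynomial n p x))"

text \<open>A list of triples (g, A, b) stands for the disjunction of the formulas
  g(x) and x' = A x + b.\<close>

type_synonym transition = "(guard \<times> rat mat \<times> rat vec) list"

definition wf_transition :: "nat \<Rightarrow> transition \<Rightarrow> bool" where
  "wf_transition n t \<longleftrightarrow>
     (\<forall>(g, A, b) \<in> set t. wf_guard n g \<and> A \<in> carrier_mat n n \<and> b \<in> carrier_vec n)"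

definition transition_rel :: "nat \<Rightarrow> transition \<Rightarrow> (rat vec \<times> rat vec) set" where
  "transition_rel n t =
     {(x, x'). x \<in> carrier_vec n \<and> x' \<in> carrier_vec n \<and>
        (\<exists>(g, A, b) \<in> set t. holds_guard n g x \<and> x' = A *\<^sub>v x + b)}"

datatype control = C_init | C_bad

record system =
  sys_dim :: nat
  sys_trans :: "control \<Rightarrow> control \<Rightarrow> transition"
  sys_start :: "rat vec"

definition wf_system :: "system \<Rightarrow> bool" where
  "wf_system S \<longleftrightarrow>
     (\<forall>j k. wf_transition (sys_dim S) (sys_trans S j k)) \<and>
     sys_start S \<in> carrier_vec (sys_dim S)"

definition has_polyhedral_separating_invariant :: "system \<Rightarrow> bool" where
  "has_polyhedral_separating_invariant S \<longleftrightarrow>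
     (\<exists>I :: control \<Rightarrow> rat vec set.
        (\<forall>j. convex_polyhedron (sys_dim S) (I j)) \<and>
        sys_start S \<in> I C_init \<and>
        I C_bad = {} \<and>
        (\<forall>j k. \<forall>x \<in> carrier_vec (sys_dim S). \<forall>x' \<in> carrier_vec (sys_dim S).
           x \<in> I j \<and> (x, x') \<in> transition_rel (sys_dim S) (sys_trans S j k) \<longrightarrow> x' \<in> I k))"


section \<open>Turing machines and decidability\<close>

datatype symbol = Digit0 | Digit1 | Minus | LParen | RParen

text \<open>Deterministic single-tape machines over an arbitrary finite tape alphabet. States and tape
  symbols are initial segments of the naturals; the tape symbol 0 is the blank and 1 to 5 are
  the input symbols.\<close>

fun tape_symbol :: "symbol \<Rightarrow> nat" where
  "tape_symbol Digit0 = 1"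
| "tape_symbol Digit1 = 2"
| "tape_symbol Minus = 3"
| "tape_symbol LParen = 4"
| "tape_symbol RParen = 5"

datatype move = MoveLeft | MoveRight | Stay

record turing_machine =
  tm_states :: nat
  tm_symbols :: nat
  tm_delta :: "nat \<Rightarrow> nat \<Rightarrow> nat \<times> nat \<times> move"
  tm_start :: nat
  tm_accept :: nat
  tm_reject :: nat

definition wf_tm :: "turing_machine \<Rightarrow> bool" where
  "wf_tm M \<longleftrightarrow>
     tm_start M < tm_states M \<and> tm_accept M < tm_states M \<and> tm_reject M < tm_states M \<and>
     tm_accept M \<noteq> tm_reject M \<and> (\<forall>a. tape_symbol a < tm_symbols M) \<and>
     (\<forall>q < tm_states M. \<forall>s < tm_symbols M.
        case tm_delta M q s of (q', s', d) \<Rightarrow> q' < tm_states M \<and> s' < tm_symbols M)"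

text \<open>The configuration (q, ls, rs) has state q, the tape content ls to the left of the head,
  nearest cell first, and the content rs from the scanned cell on; all further cells on both
  sides are blank.\<close>

type_synonym config = "nat \<times> nat list \<times> nat list"

fun head_symbol :: "nat list \<Rightarrow> nat" where
  "head_symbol [] = 0"
| "head_symbol (s # ss) = s"

fun move_head :: "move \<Rightarrow> nat list \<times> nat list \<Rightarrow> nat list \<times> nat list" where
  "move_head MoveLeft (ls, rs) = (tl ls, head_symbol ls # rs)"
| "move_head MoveRight (ls, rs) = (head_symbol rs # ls, tl rs)"
| "move_head Stay (ls, rs) = (ls, rs)"

fun tm_step :: "turing_machine \<Rightarrow> config \<Rightarrow> config" where
  "tm_step M (q, ls, rs) =
     (if q = tm_accept M \<or> q = tm_reject M then (q, ls, rs)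
      else case tm_delta M q (head_symbol rs) of
        (q', s, d) \<Rightarrow> (q', move_head d (ls, s # tl rs)))"

definition tm_run :: "turing_machine \<Rightarrow> symbol list \<Rightarrow> nat \<Rightarrow> config" where
  "tm_run M w t = (tm_step M ^^ t) (tm_start M, [], map tape_symbol w)"

definition tm_accepts :: "turing_machine \<Rightarrow> symbol list \<Rightarrow> bool" where
  "tm_accepts M w \<longleftrightarrow> (\<exists>t. fst (tm_run M w t) = tm_accept M)"

definition tm_rejects :: "turing_machine \<Rightarrow> symbol list \<Rightarrow> bool" where
  "tm_rejects M w \<longleftrightarrow> (\<exists>t. fst (tm_run M w t) = tm_reject M)"

text \<open>The problem with instances in D, presented to the machine as strings by enc, and question Q.
  Behaviour on strings that present no instance is unconstrained.\<close>

definition decidable :: "('a \<Rightarrow> symbol list) \<Rightarrow> 'a set \<Rightarrow> ('a \<Rightarrow> bool) \<Rightarrow> bool" where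
  "decidable enc D Q \<longleftrightarrow>
     (\<exists>M. wf_tm M \<and>
        (\<forall>x \<in> D. if Q x then tm_accepts M (enc x) else tm_rejects M (enc x)))"


section \<open>Presenting systems as strings\<close>

fun binary :: "nat \<Rightarrow> symbol list" where
  "binary n = (if n < 2 then [] else binary (n div 2)) @ [if even n then Digit0 else Digit1]"

declare binary.simps [simp del]

definition enc_nat :: "nat \<Rightarrow> symbol list" where
  "enc_nat n = LParen # binary n @ [RParen]"

definition enc_int :: "int \<Rightarrow> symbol list" where
  "enc_int i = (if i < 0 then [Minus] else []) @ enc_nat (nat \<bar>i\<bar>)"

definition enc_rat :: "rat \<Rightarrow> symbol list" where
  "enc_rat r = (case quotient_of r of (p, q) \<Rightarrow> enc_int p @ enc_int q)"

definition enc_list :: "('a \<Rightarrow> symbol list) \<Rightarrow> 'a list \<Rightarrow> symbol list" where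
  "enc_list f xs = LParen # concat (map f xs) @ [RParen]"

definition enc_pair :: "('a \<Rightarrow> symbol list) \<Rightarrow> ('b \<Rightarrow> symbol list) \<Rightarrow> 'a \<times> 'b \<Rightarrow> symbol list" where
  "enc_pair f g = (\<lambda>(x, y). f x @ g y)"

definition enc_vec :: "rat vec \<Rightarrow> symbol list" where
  "enc_vec v = enc_list enc_rat (list_of_vec v)"

definition enc_mat :: "rat mat \<Rightarrow> symbol list" where
  "enc_mat A = enc_list (enc_list enc_rat) (mat_to_list A)"

definition enc_polynomial :: "polynomial \<Rightarrow> symbol list" where
  "enc_polynomial = enc_list (enc_pair enc_rat (enc_list enc_nat))"

fun enc_comparison :: "comparison \<Rightarrow> symbol list" where
  "enc_comparison EQ = enc_nat 0"
| "enc_comparison LT = enc_nat 1"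
| "enc_comparison LE = enc_nat 2"
| "enc_comparison GT = enc_nat 3"
| "enc_comparison GE = enc_nat 4"

definition enc_transition :: "transition \<Rightarrow> symbol list" where
  "enc_transition =
     enc_list (enc_pair (enc_list (enc_pair enc_polynomial enc_comparison))
                        (enc_pair enc_mat enc_vec))"

definition enc_system :: "system \<Rightarrow> symbol list" where
  "enc_system S =
     enc_nat (sys_dim S) @
     enc_transition (sys_trans S C_init C_init) @ enc_transition (sys_trans S C_init C_bad) @
     enc_transition (sys_trans S C_bad C_init) @ enc_transition (sys_trans S C_bad C_bad) @
     enc_vec (sys_start S)"

text \<open>Distinct well-formed systems are presented by distinct strings, so that undecidability
  cannot be an artefact of the presentation.\<close>

definition prefix_code_on :: "'a set \<Rightarrow> ('a \<Rightarrow> symbol list) \<Rightarrow> bool" where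
  "prefix_code_on D f \<longleftrightarrow>
     (\<forall>x \<in> D. \<forall>y \<in> D. \<forall>u v. f x @ u = f y @ v \<longrightarrow> x = y \<and> u = v) \<and>
     (\<forall>x \<in> D. \<exists>a w. f x = a # w \<and> a \<noteq> RParen)"

lemma prefix_code_onD:
  "prefix_code_on D f \<Longrightarrow> x \<in> D \<Longrightarrow> y \<in> D \<Longrightarrow> f x @ u = f y @ v \<Longrightarrow> x = y \<and> u = v"
  unfolding prefix_code_on_def by blast

lemma binary_inject: "binary m = binary n \<Longrightarrow> m = n"
proof (induction m arbitrary: n rule: less_induct)
  case (less m)
  have ne: "binary k \<noteq> []" for k by (subst binary.simps) auto
  have par: "even m = even n"
    using less.prems by (subst (asm) binary.simps, subst (asm) (2) binary.simps) (auto split: if_splits)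
  have init: "(if m < 2 then [] else binary (m div 2)) = (if n < 2 then [] else binary (n div 2))"
    using less.prems by (subst (asm) binary.simps, subst (asm) (2) binary.simps) simp
  show ?case
  proof (cases "m < 2")
    case True
    with init ne have "n < 2" by (metis)
    with True par show ?thesis by (auto simp: less_2_cases_iff)
  next
    case False
    with init ne have n: "\<not> n < 2" by metis
    with False init have "m div 2 = n div 2" using less.IH[of "m div 2" "n div 2"] by simp
    with par show ?thesis by (metis even_two_times_div_two odd_two_times_div_two_succ)
  qed
qed

lemma RParen_notin_binary: "RParen \<notin> set (binary n)"
  by (induction n rule: binary.induct) (subst binary.simps, auto)

lemma append_delim:
  "xs @ a # u = ys @ a # v \<Longrightarrow> a \<notin> set xs \<Longrightarrow> a \<notin> set ys \<Longrightarrow> xs = ys \<and> u = v"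
proof (induction xs arbitrary: ys)
  case Nil
  then show ?case by (cases ys) auto
next
  case (Cons x xs)
  then show ?case by (cases ys) auto
qed

lemma prefix_code_enc_nat: "prefix_code_on D enc_nat"
proof -
  have "x = y \<and> u = v" if "enc_nat x @ u = enc_nat y @ v" for x y u v
    using that append_delim[of "binary x" RParen u "binary y" v]
    by (auto simp: enc_nat_def RParen_notin_binary intro: binary_inject)
  moreover have "\<exists>a w. enc_nat x = a # w \<and> a \<noteq> RParen" for x
    by (simp add: enc_nat_def)
  ultimately show ?thesis unfolding prefix_code_on_def by blast
qed

lemma prefix_code_enc_int: "prefix_code_on D enc_int"
proof -
  have "x = y \<and> u = v" if "enc_int x @ u = enc_int y @ v" for x y u v
  proof -
    have sgn: "(x < 0) = (y < 0)"
      using that by (auto simp: enc_int_def enc_nat_def split: if_splits)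
    have "enc_nat (nat \<bar>x\<bar>) @ u = enc_nat (nat \<bar>y\<bar>) @ v"
      using that sgn by (auto simp: enc_int_def split: if_splits)
    then have "nat \<bar>x\<bar> = nat \<bar>y\<bar> \<and> u = v"
      by (rule prefix_code_onD[OF prefix_code_enc_nat[of UNIV], rotated 2]) auto
    with sgn show ?thesis by linarith
  qed
  moreover have "\<exists>a w. enc_int x = a # w \<and> a \<noteq> RParen" for x
    by (cases "x < 0") (simp_all add: enc_int_def enc_nat_def)
  ultimately show ?thesis unfolding prefix_code_on_def by blast
qed

lemma prefix_code_enc_pair:
  assumes "prefix_code_on A f" "prefix_code_on B g" "D \<subseteq> A \<times> B"
  shows "prefix_code_on D (enc_pair f g)"
  unfolding prefix_code_on_def
proof (intro conjI ballI allI impI)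
  fix x y u v assume xy: "x \<in> D" "y \<in> D" and eq: "enc_pair f g x @ u = enc_pair f g y @ v"
  obtain x1 x2 y1 y2 where p: "x = (x1, x2)" "y = (y1, y2)" by (cases x, cases y)
  have m: "x1 \<in> A" "y1 \<in> A" "x2 \<in> B" "y2 \<in> B" using xy p assms(3) by auto
  have "f x1 @ (g x2 @ u) = f y1 @ (g y2 @ v)" using eq p by (simp add: enc_pair_def)
  from prefix_code_onD[OF assms(1) m(1,2) this]
  have "x1 = y1" and "g x2 @ u = g y2 @ v" by auto
  with prefix_code_onD[OF assms(2) m(3,4)] p show "x = y" "u = v" by auto
next
  fix x assume "x \<in> D"
  then have "fst x \<in> A" using assms(3) by auto
  then obtain a w where "f (fst x) = a # w" "a \<noteq> RParen"
    using assms(1) unfolding prefix_code_on_def by blast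
  then show "\<exists>a w. enc_pair f g x = a # w \<and> a \<noteq> RParen"
    by (simp add: enc_pair_def case_prod_beta)
qed

lemma prefix_code_enc_list:
  assumes "prefix_code_on A f" "D \<subseteq> {xs. set xs \<subseteq> A}"
  shows "prefix_code_on D (enc_list f)"
proof -
  have *: "xs = ys \<and> u = v"
    if "set xs \<subseteq> A" "set ys \<subseteq> A" "concat (map f xs) @ RParen # u = concat (map f ys) @ RParen # v"
    for xs ys u v
    using that
  proof (induction xs arbitrary: ys)
    case Nil
    show ?case
    proof (cases ys)
      case (Cons y ys')
      then have "y \<in> A" using Nil by auto
      then obtain a w where "f y = a # w" "a \<noteq> RParen"
        using assms(1) unfolding prefix_code_on_def by blast
      then show ?thesis using Nil Cons by auto
    qed (use Nil in auto)
  next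
    case (Cons x xs)
    then have x: "x \<in> A" by auto
    show ?case
    proof (cases ys)
      case Nil
      obtain a w where "f x = a # w" "a \<noteq> RParen"
        using assms(1) x unfolding prefix_code_on_def by blast
      then show ?thesis using Cons.prems Nil by auto
    next
      case ys: (Cons y ys')
      then have y: "y \<in> A" using Cons.prems by auto
      have "f x @ (concat (map f xs) @ RParen # u) = f y @ (concat (map f ys') @ RParen # v)"
        using Cons.prems ys by simp
      from prefix_code_onD[OF assms(1) x y this]
      have "x = y" "concat (map f xs) @ RParen # u = concat (map f ys') @ RParen # v" by auto
      then show ?thesis using Cons.IH[of ys'] Cons.prems ys by auto
    qed
  qed
  show ?thesis
    unfolding prefix_code_on_def
  proof (intro conjI ballI allI impI)
    fix xs ys u v assume "xs \<in> D" "ys \<in> D" "enc_list f xs @ u = enc_list f ys @ v"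
    then have "xs = ys \<and> u = v"
      using *[of xs ys u v] assms(2) by (auto simp: enc_list_def)
    then show "xs = ys" "u = v" by auto
  qed (simp add: enc_list_def)
qed

lemma prefix_code_map:
  assumes "prefix_code_on A f" "inj_on h D" "h ` D \<subseteq> A" "\<And>x. x \<in> D \<Longrightarrow> g x = f (h x)"
  shows "prefix_code_on D g"
  unfolding prefix_code_on_def
proof (intro conjI ballI allI impI)
  fix x y u v assume xy: "x \<in> D" "y \<in> D" and "g x @ u = g y @ v"
  then have "f (h x) @ u = f (h y) @ v" using assms(4) by simp
  then have "h x = h y \<and> u = v" using prefix_code_onD[OF assms(1)] xy assms(3) by blast
  then show "x = y" "u = v" using assms(2) xy by (auto dest: inj_onD)
next
  fix x assume "x \<in> D"
  then have "h x \<in> A" and gx: "g x = f (h x)" using assms(3,4) by auto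
  then obtain a w where "f (h x) = a # w" "a \<noteq> RParen"
    using assms(1) unfolding prefix_code_on_def by blast
  then show "\<exists>a w. g x = a # w \<and> a \<noteq> RParen" using gx by simp
qed

lemma prefix_code_enc_rat: "prefix_code_on D enc_rat"
proof (rule prefix_code_map)
  show "prefix_code_on UNIV (enc_pair enc_int enc_int)"
    by (rule prefix_code_enc_pair[OF prefix_code_enc_int[of UNIV] prefix_code_enc_int[of UNIV]]) simp
  show "inj_on quotient_of D" by (auto intro: inj_onI simp: quotient_of_inject)
qed (auto simp: enc_rat_def enc_pair_def)

lemma prefix_code_enc_vec: "prefix_code_on D enc_vec"
proof (rule prefix_code_map)
  show "prefix_code_on UNIV (enc_list enc_rat)"
    by (rule prefix_code_enc_list[OF prefix_code_enc_rat[of UNIV]]) simp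
  show "inj_on list_of_vec D" by (rule inj_onI) (metis vec_list)
qed (auto simp: enc_vec_def)

lemma prefix_code_enc_mat: "prefix_code_on (carrier_mat n m) enc_mat"
proof (rule prefix_code_map)
  show "prefix_code_on UNIV (enc_list (enc_list enc_rat))"
    by (rule prefix_code_enc_list[OF prefix_code_enc_list[OF prefix_code_enc_rat[of UNIV], of UNIV]])
      simp_all
  show "inj_on mat_to_list (carrier_mat n m :: rat mat set)"
    by (rule inj_onI, rule eq_matI) (auto simp: mat_to_list_def)
qed (auto simp: enc_mat_def)

lemma prefix_code_enc_comparison: "prefix_code_on D enc_comparison"
proof (rule prefix_code_map)
  let ?h = "\<lambda>c. case c of EQ \<Rightarrow> 0 | LT \<Rightarrow> 1 | LE \<Rightarrow> 2 | GT \<Rightarrow> 3 | GE \<Rightarrow> (4::nat)"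
  show "prefix_code_on UNIV enc_nat" by (rule prefix_code_enc_nat)
  show "inj_on ?h D" by (rule inj_onI) (auto split: comparison.splits)
  show "enc_comparison c = enc_nat (?h c)" for c by (cases c) auto
qed auto

lemma prefix_code_enc_transition: "prefix_code_on {t. wf_transition n t} enc_transition"
proof -
  have p: "prefix_code_on UNIV enc_polynomial"
    unfolding enc_polynomial_def
    by (rule prefix_code_enc_list[OF prefix_code_enc_pair[OF prefix_code_enc_rat[of UNIV]
          prefix_code_enc_list[OF prefix_code_enc_nat[of UNIV], of UNIV], of UNIV]]) auto
  have g: "prefix_code_on UNIV (enc_list (enc_pair enc_polynomial enc_comparison))"
    by (rule prefix_code_enc_list[OF prefix_code_enc_pair[OF p
          prefix_code_enc_comparison[of UNIV], of UNIV]]) auto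
  have ab: "prefix_code_on (carrier_mat n n \<times> carrier_vec n) (enc_pair enc_mat enc_vec)"
    by (rule prefix_code_enc_pair[OF prefix_code_enc_mat prefix_code_enc_vec]) (rule subset_refl)
  show ?thesis
    unfolding enc_transition_def
    by (rule prefix_code_enc_list[OF prefix_code_enc_pair[OF g ab subset_refl]])
      (auto simp: wf_transition_def)
qed

lemma inj_on_enc_system: "inj_on enc_system {S. wf_system S}"
proof (rule inj_onI)
  fix S T assume "S \<in> {S. wf_system S}" "T \<in> {S. wf_system S}" and eq: "enc_system S = enc_system T"
  then have S: "wf_transition (sys_dim S) (sys_trans S j k)"
    and T: "wf_transition (sys_dim T) (sys_trans T j k)" for j k
    by (auto simp: wf_system_def)
  note tr = prefix_code_onD[OF prefix_code_enc_transition]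
  note e = eq[unfolded enc_system_def]
  have dim: "sys_dim S = sys_dim T" and e1: "enc_transition (sys_trans S C_init C_init) @
     enc_transition (sys_trans S C_init C_bad) @ enc_transition (sys_trans S C_bad C_init) @
     enc_transition (sys_trans S C_bad C_bad) @ enc_vec (sys_start S)
     = enc_transition (sys_trans T C_init C_init) @
     enc_transition (sys_trans T C_init C_bad) @ enc_transition (sys_trans T C_bad C_init) @
     enc_transition (sys_trans T C_bad C_bad) @ enc_vec (sys_start T)"
    using prefix_code_onD[OF prefix_code_enc_nat[of UNIV] _ _ e] by auto
  have S': "sys_trans S j k \<in> {t. wf_transition (sys_dim S) t}"
    and T': "sys_trans T j k \<in> {t. wf_transition (sys_dim S) t}" for j k
    using S T dim by auto
  from tr[OF S' T' e1] have t1: "sys_trans S C_init C_init = sys_trans T C_init C_init"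
    and e2: "enc_transition (sys_trans S C_init C_bad) @
     enc_transition (sys_trans S C_bad C_init) @
     enc_transition (sys_trans S C_bad C_bad) @ enc_vec (sys_start S)
     = enc_transition (sys_trans T C_init C_bad) @ enc_transition (sys_trans T C_bad C_init) @
     enc_transition (sys_trans T C_bad C_bad) @ enc_vec (sys_start T)" by auto
  from tr[OF S' T' e2] have t2: "sys_trans S C_init C_bad = sys_trans T C_init C_bad"
    and e3: "enc_transition (sys_trans S C_bad C_init) @
     enc_transition (sys_trans S C_bad C_bad) @ enc_vec (sys_start S)
     = enc_transition (sys_trans T C_bad C_init) @
     enc_transition (sys_trans T C_bad C_bad) @ enc_vec (sys_start T)" by auto
  from tr[OF S' T' e3] have t3: "sys_trans S C_bad C_init = sys_trans T C_bad C_init"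
    and e4: "enc_transition (sys_trans S C_bad C_bad) @ enc_vec (sys_start S)
     = enc_transition (sys_trans T C_bad C_bad) @ enc_vec (sys_start T)" by auto
  from tr[OF S' T' e4] have t4: "sys_trans S C_bad C_bad = sys_trans T C_bad C_bad"
    and e5: "enc_vec (sys_start S) @ [] = enc_vec (sys_start T) @ []" by auto
  have x0: "sys_start S = sys_start T"
    using prefix_code_onD[OF prefix_code_enc_vec[of UNIV] _ _ e5] by auto
  have "sys_trans S j k = sys_trans T j k" for j k
    using t1 t2 t3 t4 by (cases j; cases k) auto
  then have "sys_trans S = sys_trans T" by blast
  with dim x0 show "S = T" by simp
qed

end

theory Submission
  imports Defs
begin

text \<open>Given a machine M, a piecewise affine system can write down its own presentation and run M on
  it: the presentation consists of a fixed string w and the binary digits of the last coordinate of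
  the initial point, and w is stored as the base B digits of that coordinate. If M accepts, the
  system enters the bad state, so there is no invariant. If M rejects, the system stops; the
  polynomial guards x_1 = x_0^2 keep the time on a parabola, and a polyhedron can be chosen that
  meets this parabolic hypersurface only in the points of the finite trajectory, so there is an
  invariant. In both cases the answer of M is wrong.\<close>

section \<open>Affine rules with a clock on a parabola\<close>

text \<open>An affine form as coefficients and constant. The coefficients are a function on all
  indices, so forms can be written down without a dimension.\<close>

type_synonym aff = "(nat \<Rightarrow> rat) \<times> rat"

definition aff_eval :: "nat \<Rightarrow> aff \<Rightarrow> rat vec \<Rightarrow> rat" where
  "aff_eval n a x = (\<Sum>i<n. fst a i * x $ i) + snd a"

definition avar :: "nat \<Rightarrow> aff" where
  "avar i = (\<lambda>j. if j = i then 1 else 0, 0)"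

definition aconst :: "rat \<Rightarrow> aff" where
  "aconst c = (\<lambda>_. 0, c)"

definition aadd :: "aff \<Rightarrow> aff \<Rightarrow> aff" where
  "aadd a b = (\<lambda>i. fst a i + fst b i, snd a + snd b)"

definition ascale :: "rat \<Rightarrow> aff \<Rightarrow> aff" where
  "ascale c a = (\<lambda>i. c * fst a i, c * snd a)"

abbreviation asub :: "aff \<Rightarrow> aff \<Rightarrow> aff" where
  "asub a b \<equiv> aadd a (ascale (-1) b)"

lemma aff_eval_simps [simp]:
  "i < n \<Longrightarrow> aff_eval n (avar i) x = x $ i"
  "aff_eval n (aconst c) x = c"
  "aff_eval n (aadd a b) x = aff_eval n a x + aff_eval n b x"
  "aff_eval n (ascale c a) x = c * aff_eval n a x"
proof -
  show "aff_eval n (avar i) x = x $ i" if "i < n"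
  proof -
    have "(\<Sum>j<n. (if j = i then 1 else 0) * x $ j) = (\<Sum>j<n. if j = i then x $ i else 0)"
      by (rule sum.cong) auto
    then show ?thesis using that by (simp add: aff_eval_def avar_def)
  qed
  show "aff_eval n (aadd a b) x = aff_eval n a x + aff_eval n b x"
    by (simp add: aff_eval_def aadd_def sum.distrib distrib_right)
  show "aff_eval n (ascale c a) x = c * aff_eval n a x"
    by (simp add: aff_eval_def ascale_def sum_distrib_left distrib_left mult.assoc)
qed (simp add: aff_eval_def aconst_def)

lemma convex_polyhedron_aff:
  assumes "finite F"
  shows "convex_polyhedron n {x \<in> carrier_vec n. \<forall>a\<in>F. aff_eval n a x \<le> 0}"
  unfolding convex_polyhedron_def
proof (intro exI conjI)
  let ?I = "(\<lambda>a. (vec n (fst a), - snd a)) ` F"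
  have "vec n (fst a) \<bullet> x \<le> - snd a \<longleftrightarrow> aff_eval n a x \<le> 0" if "x \<in> carrier_vec n" for a x
  proof -
    have "vec n (fst a) \<bullet> x = (\<Sum>i<n. fst a i * x $ i)"
      using that by (auto simp: scalar_prod_def lessThan_atLeast0)
    then show ?thesis by (simp add: aff_eval_def) linarith
  qed
  then show "{x \<in> carrier_vec n. \<forall>a\<in>F. aff_eval n a x \<le> 0} =
    {x \<in> carrier_vec n. (\<forall>(a, \<beta>)\<in>?I. a \<bullet> x \<le> \<beta>) \<and> (\<forall>(a, \<beta>)\<in>{}. a \<bullet> x = \<beta>)}"
    by auto
qed (use assms in auto)

definition aff_polynomial :: "nat \<Rightarrow> aff \<Rightarrow> polynomial" where
  "aff_polynomial n a =
     (snd a, replicate n 0) # map (\<lambda>i. (fst a i, (replicate n 0)[i := 1])) [0..<n]"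

lemma prod_unit_power:
  fixes x :: "rat vec"
  assumes "i < n"
  shows "(\<Prod>j<n. x $ j ^ ((replicate n 0)[i := k] ! j)) = x $ i ^ k"
proof -
  have "(\<Prod>j<n. x $ j ^ ((replicate n 0)[i := k] ! j)) = (\<Prod>j<n. if j = i then x $ i ^ k else 1)"
    by (rule prod.cong) (auto simp: nth_list_update)
  then show ?thesis using assms by simp
qed

lemma eval_aff_polynomial: "eval_polynomial n (aff_polynomial n a) x = aff_eval n a x"
proof -
  have "(\<Sum>i\<leftarrow>[0..<n]. fst a i * (\<Prod>j<n. x $ j ^ ((replicate n 0)[i := 1] ! j)))
      = (\<Sum>i<n. fst a i * (\<Prod>j<n. x $ j ^ ((replicate n 0)[i := 1] ! j)))"
    by (simp add: interv_sum_list_conv_sum_set_nat lessThan_atLeast0)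
  also have "\<dots> = (\<Sum>i<n. fst a i * x $ i)"
    by (rule sum.cong) (auto simp: prod_unit_power)
  finally show ?thesis
    by (simp add: eval_polynomial_def aff_polynomial_def aff_eval_def comp_def)
qed

definition parabola_polynomial :: "nat \<Rightarrow> polynomial" where
  "parabola_polynomial n = [(1, (replicate n 0)[1 := 1]), (-1, (replicate n 0)[0 := 2])]"

lemma eval_parabola_polynomial:
  "2 \<le> n \<Longrightarrow> eval_polynomial n (parabola_polynomial n) x = x $ 1 - (x $ 0)\<^sup>2"
  using prod_unit_power[of 1 n x 1] prod_unit_power[of 0 n x 2]
  by (simp add: eval_polynomial_def parabola_polynomial_def)

section \<open>Rules and their translation into guarded affine transitions\<close>

type_synonym rule = "(aff \<times> comparison) list \<times> (nat \<Rightarrow> aff)"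

text \<open>Since (t + 1)^2 = t^2 + 2 t + 1 is affine in t and t^2, affine assignments can carry the
  square of the time along.\<close>

definition ticking :: "(nat \<Rightarrow> aff) \<Rightarrow> nat \<Rightarrow> aff" where
  "ticking u = u(0 := aadd (avar 0) (aconst 1),
                 1 := aadd (avar 1) (aadd (ascale 2 (avar 0)) (aconst 1)))"

definition rule_holds :: "nat \<Rightarrow> rule \<Rightarrow> rat vec \<Rightarrow> bool" where
  "rule_holds n r x \<longleftrightarrow> (\<forall>(a, c) \<in> set (fst r). compare_zero c (aff_eval n a x))"

definition rule_apply :: "nat \<Rightarrow> rule \<Rightarrow> rat vec \<Rightarrow> rat vec" where
  "rule_apply n r x = vec n (\<lambda>i. aff_eval n (ticking (snd r) i) x)"

text \<open>The parabola equation, the only nonlinear guard, is put on every transition: points of a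
  polyhedron that lie off the parabola then have no successor.\<close>

definition compile :: "nat \<Rightarrow> rule \<Rightarrow> guard \<times> rat mat \<times> rat vec" where
  "compile n r = ((parabola_polynomial n, EQ) # map (\<lambda>(a, c). (aff_polynomial n a, c)) (fst r),
     mat n n (\<lambda>(i, j). fst (ticking (snd r) i) j), vec n (\<lambda>i. snd (ticking (snd r) i)))"

lemma wf_transition_compile: "wf_transition n (map (compile n) rs)"
  by (auto simp: wf_transition_def compile_def wf_guard_def wf_polynomial_def
      parabola_polynomial_def aff_polynomial_def)

lemma transition_rel_compile:
  assumes "2 \<le> n"
  shows "(x, x') \<in> transition_rel n (map (compile n) rs) \<longleftrightarrow>
    dim_vec x = n \<and> x $ 1 = (x $ 0)\<^sup>2 \<and> (\<exists>r\<in>set rs. rule_holds n r x \<and> x' = rule_apply n r x)"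
proof (cases "dim_vec x = n")
  case True
  have "mat n n (\<lambda>(i, j). fst (ticking (snd r) i) j) *\<^sub>v x + vec n (\<lambda>i. snd (ticking (snd r) i))
      = rule_apply n r x" for r
    using True by (intro eq_vecI)
      (auto simp: rule_apply_def aff_eval_def scalar_prod_def lessThan_atLeast0)
  moreover have "holds_guard n (fst (compile n r)) x \<longleftrightarrow> x $ 1 = (x $ 0)\<^sup>2 \<and> rule_holds n r x" for r
    using assms by (auto simp: holds_guard_def compile_def rule_holds_def
        eval_parabola_polynomial eval_aff_polynomial)
  ultimately have eq: "(case compile n r of (g, A, b) \<Rightarrow> holds_guard n g x \<and> x' = A *\<^sub>v x + b) \<longleftrightarrow>
      x $ 1 = (x $ 0)\<^sup>2 \<and> rule_holds n r x \<and> x' = rule_apply n r x" for r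
    by (simp add: compile_def)
  have "x \<in> carrier_vec n" using True by (rule carrier_vecI)
  moreover have "rule_apply n r x \<in> carrier_vec n" for r
    by (simp add: rule_apply_def)
  ultimately show ?thesis
    using True unfolding transition_rel_def mem_Collect_eq prod.case set_map bex_simps eq by blast
next
  case False
  then show ?thesis by (auto simp: transition_rel_def)
qed

lemma rule_apply_clock:
  assumes "2 \<le> n"
  shows "rule_apply n r x $ 0 = x $ 0 + 1" "rule_apply n r x $ 1 = x $ 1 + 2 * x $ 0 + 1"
  using assms by (simp_all add: rule_apply_def ticking_def)


section \<open>Invariants of finite trajectories on a parabola\<close>

text \<open>On the parabola the affine form x_1 - 2 i x_0 + i^2 equals (x_0 - i)^2, so it vanishes at
  time i and is at least 1 at the other integer times. A large multiple of it therefore relaxes an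
  equation that is meant for time i only. The chords of the parabola exclude non-integer times.\<close>

lemma trajectory_polyhedron:
  fixes f :: "nat \<Rightarrow> rat vec"
  assumes n: "2 \<le> n" and carr: "\<And>i. i \<le> N \<Longrightarrow> f i \<in> carrier_vec n"
    and f0: "\<And>i. i \<le> N \<Longrightarrow> f i $ 0 = of_nat i" and f1: "\<And>i. i \<le> N \<Longrightarrow> f i $ 1 = (of_nat i)\<^sup>2"
  obtains P where "convex_polyhedron n P" "\<And>i. i \<le> N \<Longrightarrow> f i \<in> P"
    "\<And>x. x \<in> P \<Longrightarrow> x $ 1 = (x $ 0)\<^sup>2 \<Longrightarrow> x \<in> f ` {..N}"
proof -
  define G where "G = (\<lambda>(i, j, c). \<bar>f j $ c - f i $ c\<bar>) ` ({..N} \<times> {..N} \<times> {..<n})"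
  have "finite G" by (auto simp: G_def)
  then obtain K0 where K0: "\<And>g. g \<in> G \<Longrightarrow> g \<le> K0"
    by (meson bdd_above_finite bdd_above_def)
  define K where "K = max K0 0"
  have K: "\<bar>f j $ c - f i $ c\<bar> \<le> K" if "i \<le> N" "j \<le> N" "c < n" for i j c
  proof -
    have "\<bar>f j $ c - f i $ c\<bar> \<in> G" using that unfolding G_def by force
    then show ?thesis using K0 by (force simp: K_def)
  qed
  have K_ge: "0 \<le> K" by (simp add: K_def)
  define near where
    "near i = aadd (avar 1) (aadd (ascale (- 2 * of_nat i) (avar 0)) (aconst ((of_nat i)\<^sup>2)))" for i :: nat
  have near: "aff_eval n (near i) x = (x $ 0 - of_nat i)\<^sup>2" if "x $ 1 = (x $ 0)\<^sup>2" for i x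
    using n that by (simp add: near_def power2_eq_square algebra_simps)
  \<comment> \<open>The line through (i, i^2) and (i + 1, (i + 1)^2). The constraint asks for points
    on or above it, while the parabola lies strictly below it between the two times.\<close>
  define chord where
    "chord i = aadd (ascale (2 * of_nat i + 1) (avar 0)) (aadd (ascale (-1) (avar 1))
       (aconst (- of_nat i * (of_nat i + 1))))" for i :: nat
  have chord: "aff_eval n (chord i) x = - ((x $ 0 - of_nat i) * (x $ 0 - of_nat i - 1))"
    if "x $ 1 = (x $ 0)\<^sup>2" for i x
    using n that by (simp add: chord_def power2_eq_square algebra_simps)
  \<comment> \<open>Taking \<open>e\<close> as 1 and -1 gives an equation for coordinate
    \<open>c\<close> at time i. At every other integer time the subtracted term is at least
    \<open>K\<close>, which bounds all coordinate differences along the trajectory.\<close>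
  define bound where
    "bound e i c = aadd (ascale e (asub (avar c) (aconst (f i $ c)))) (ascale (- K) (near i))"
    for e i c
  have bound: "aff_eval n (bound e i c) x = e * (x $ c - f i $ c) - K * (x $ 0 - of_nat i)\<^sup>2"
    if "x $ 1 = (x $ 0)\<^sup>2" "c < n" for e i c x
    using that by (simp add: bound_def near algebra_simps)
  define F where "F = {ascale (-1) (avar 0), asub (avar 0) (aconst (of_nat N))} \<union> chord ` {..<N}
    \<union> (\<lambda>(e, i, c). bound e i c) ` ({1, -1} \<times> {..N} \<times> {..<n})"
  define P where "P = {x \<in> carrier_vec n. \<forall>a\<in>F. aff_eval n a x \<le> 0}"
  show thesis
  proof
    show "convex_polyhedron n P"
      unfolding P_def by (rule convex_polyhedron_aff) (auto simp: F_def)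
  next
    fix j assume j: "j \<le> N"
    have par: "f j $ 1 = (f j $ 0)\<^sup>2" using f0 f1 j by simp
    have "aff_eval n (chord i) (f j) \<le> 0" for i
    proof -
      \<comment> \<open>The factors are consecutive integers, so they never have opposite
        signs.\<close>
      have "0 \<le> (int j - int i) * (int j - int i - 1)"
        by (cases "j \<le> i") (auto simp: mult_nonpos_nonpos)
      then have "0 \<le> (of_int ((int j - int i) * (int j - int i - 1)) :: rat)"
        by (rule of_int_nonneg)
      then show ?thesis using j by (simp add: chord[OF par] f0)
    qed
    moreover have "aff_eval n (bound e i c) (f j) \<le> 0"
      if "e = 1 \<or> e = -1" "i \<le> N" "c < n" for e i c
    proof (cases "i = j")
      case True
      then show ?thesis using that j by (simp add: bound[OF par] f0)
    next
      case False
      have "0 < (int j - int i)\<^sup>2" using False by simp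
      then have "1 \<le> (int j - int i)\<^sup>2" by linarith
      then have "1 \<le> (of_int ((int j - int i)\<^sup>2) :: rat)" by linarith
      then have "K * 1 \<le> K * (of_nat j - of_nat i)\<^sup>2"
        by (intro mult_left_mono K_ge) simp
      moreover have "e * (f j $ c - f i $ c) \<le> K"
        using K[of i j c] that j by auto
      ultimately show ?thesis using that j by (simp add: bound[OF par] f0)
    qed
    ultimately show "f j \<in> P"
      using n j carr f0 by (auto simp: P_def F_def)
  next
    fix x assume x: "x \<in> P" and par: "x $ 1 = (x $ 0)\<^sup>2"
    have dim: "dim_vec x = n" using x by (auto simp: P_def)
    have t: "0 \<le> x $ 0" "x $ 0 \<le> of_nat N"
      using x n by (auto simp: P_def F_def)
    define i where "i = nat \<lfloor>x $ 0\<rfloor>"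
    have i: "of_nat i \<le> x $ 0" "x $ 0 < of_nat i + 1" using t by (simp_all add: i_def) linarith
    have xi: "x $ 0 = of_nat i" and iN: "i \<le> N"
    proof -
      have "(of_nat i :: rat) \<le> of_nat N" using i t by linarith
      then show iN: "i \<le> N" by simp
      show "x $ 0 = of_nat i"
      proof (cases "i = N")
        case False
        then have "aff_eval n (chord i) x \<le> 0" using x iN by (auto simp: P_def F_def)
        then have "0 \<le> (x $ 0 - of_nat i) * (x $ 0 - of_nat i - 1)" by (simp add: chord[OF par])
        then show ?thesis using i by (auto simp: zero_le_mult_iff)
      qed (use i t in auto)
    qed
    have "x $ c = f i $ c" if "c < n" for c
    proof -
      have "aff_eval n (bound 1 i c) x \<le> 0" "aff_eval n (bound (-1) i c) x \<le> 0"
        using x iN that unfolding P_def F_def by (force simp: image_iff)+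
      then show ?thesis using that by (simp add: bound[OF par] xi)
    qed
    then have "x = f i" using dim carr[OF iN] by (intro eq_vecI) auto
    then show "x \<in> f ` {..N}" using iN by auto
  qed
qed

text \<open>Take the polyhedron that meets the parabola in exactly the points of the trajectory. All
  transitions start on the parabola, so only these points can move; determinism keeps their
  successors on the trajectory, and the last point \<open>y\<close> has none. Each of them is
  \<open>y\<close> or in the domain of \<open>R\<close>, so \<open>safe\<close> rules out a move to
  the bad state.\<close>

lemma halting_invariant:
  assumes n: "2 \<le> sys_dim S"
    and R: "R = transition_rel (sys_dim S) (map (compile (sys_dim S)) rs)"
    and init: "sys_trans S C_init C_init = map (compile (sys_dim S)) rs"
    and bad: "sys_trans S C_init C_bad = map (compile (sys_dim S)) bs"
    and from_bad: "sys_trans S C_bad C_init = []" "sys_trans S C_bad C_bad = []"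
    and start: "sys_start S \<in> carrier_vec (sys_dim S)" "sys_start S $ 0 = 0" "sys_start S $ 1 = 0"
    and det: "single_valued R"
    and reach: "(sys_start S, y) \<in> R\<^sup>*" and halt: "y \<notin> Domain R"
    and safe: "\<And>x. x = y \<or> x \<in> Domain R \<Longrightarrow>
      x \<notin> Domain (transition_rel (sys_dim S) (map (compile (sys_dim S)) bs))"
  shows "has_polyhedral_separating_invariant S"
proof -
  let ?n = "sys_dim S"
  obtain N where "(sys_start S, y) \<in> R ^^ N" using reach rtrancl_imp_relpow by blast
  then obtain f where fs: "f 0 = sys_start S" "f N = y" and
    step: "\<And>i. i < N \<Longrightarrow> (f i, f (Suc i)) \<in> R"
    unfolding relpow_fun_conv by blast
  have inv: "f i \<in> carrier_vec ?n \<and> f i $ 0 = of_nat i \<and> f i $ 1 = (of_nat i)\<^sup>2" if "i \<le> N" for i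
    using that
  proof (induction i)
    case 0
    then show ?case using fs start by simp
  next
    case (Suc i)
    then have "(f i, f (Suc i)) \<in> R" using step by simp
    then obtain r where r: "f (Suc i) = rule_apply ?n r (f i)"
      unfolding R transition_rel_compile[OF n] by blast
    then have c: "f (Suc i) \<in> carrier_vec ?n" by (simp add: rule_apply_def)
    show ?case
      using Suc c rule_apply_clock[OF n, of r "f i"] by (simp add: r power2_eq_square algebra_simps)
  qed
  obtain P where P: "convex_polyhedron ?n P" "\<And>i. i \<le> N \<Longrightarrow> f i \<in> P"
    and P_par: "\<And>x. x \<in> P \<Longrightarrow> x $ 1 = (x $ 0)\<^sup>2 \<Longrightarrow> x \<in> f ` {..N}"
    by (rule trajectory_polyhedron[of ?n N f, OF n]) (use inv in auto)
  have empty: "convex_polyhedron ?n {}"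
    using convex_polyhedron_aff[of "{aconst 1}" ?n] by simp
  have par: "x $ 1 = (x $ 0)\<^sup>2" if "(x, x') \<in> transition_rel ?n (map (compile ?n) us)" for x x' us
    using that transition_rel_compile[OF n] by blast
  have P_init: "x' \<in> P" if xx: "x \<in> P" "(x, x') \<in> R" for x x'
  proof -
    obtain i where i: "i \<le> N" "x = f i" using P_par[OF xx(1) par[OF xx(2)[unfolded R]]] by auto
    have "i \<noteq> N" using i xx halt fs by auto
    then have "(x, f (Suc i)) \<in> R" using step i by simp
    then have "x' = f (Suc i)" using xx det by (metis single_valuedD)
    then show ?thesis using P(2)[of "Suc i"] i \<open>i \<noteq> N\<close> by simp
  qed
  have P_bad: False if xx: "x \<in> P" "(x, x') \<in> transition_rel ?n (map (compile ?n) bs)" for x x'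
  proof -
    obtain i where i: "i \<le> N" "x = f i" using P_par[OF xx(1) par[OF xx(2)]] by auto
    have "x = y \<or> x \<in> Domain R" using i fs step[of i] by (cases "i = N") auto
    then show False using safe xx by blast
  qed
  show ?thesis
    unfolding has_polyhedral_separating_invariant_def
  proof (intro exI conjI allI ballI impI)
    let ?I = "\<lambda>j. case j of C_init \<Rightarrow> P | C_bad \<Rightarrow> {}"
    show "convex_polyhedron ?n (?I j)" for j using P empty by (cases j) auto
    show "sys_start S \<in> ?I C_init" using P(2)[of 0] fs by simp
    show "?I C_bad = {}" by simp
    show "x' \<in> ?I k" if "x \<in> ?I j \<and> (x, x') \<in> transition_rel ?n (sys_trans S j k)" for j k x x'
      using that P_init P_bad
      by (cases j; cases k) (auto simp: init bad R from_bad transition_rel_def[of _ "[]"])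
  qed
qed

text \<open>An inductive invariant contains every reachable point, so the step to \<open>z\<close>
  would put a point into the empty set \<open>I C_bad\<close>.\<close>

lemma bad_no_invariant:
  assumes reach: "(sys_start S, y) \<in> (transition_rel (sys_dim S) (sys_trans S C_init C_init))\<^sup>*"
    and bad: "(y, z) \<in> transition_rel (sys_dim S) (sys_trans S C_init C_bad)"
  shows "\<not> has_polyhedral_separating_invariant S"
proof
  assume "has_polyhedral_separating_invariant S"
  then obtain I where I: "sys_start S \<in> I C_init" "I C_bad = {}" and
    ind: "\<And>j k x x'. x \<in> carrier_vec (sys_dim S) \<Longrightarrow> x' \<in> carrier_vec (sys_dim S) \<Longrightarrow> x \<in> I j \<Longrightarrow>
      (x, x') \<in> transition_rel (sys_dim S) (sys_trans S j k) \<Longrightarrow> x' \<in> I k"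
    unfolding has_polyhedral_separating_invariant_def by blast
  have ind': "x' \<in> I k" if "x \<in> I j" "(x, x') \<in> transition_rel (sys_dim S) (sys_trans S j k)"
    for j k x x'
    using ind[of x x' j k] that by (auto simp: transition_rel_def)
  from reach have "y \<in> I C_init" by (induction rule: rtrancl_induct) (use I ind' in auto)
  then show False using ind'[OF _ bad] I by auto
qed


section \<open>Stacks as fractions and binary expansions\<close>

text \<open>The first list element is the most significant digit after the point. The blank is the
  digit 0, so the blank cells beyond the stored list add nothing.\<close>

fun frac_of :: "nat \<Rightarrow> nat list \<Rightarrow> rat" where
  "frac_of B [] = 0"
| "frac_of B (d # ds) = (of_nat d + frac_of B ds) / of_nat B"

lemma frac_of_nonneg: "0 \<le> frac_of B ds"
  by (induction ds) auto

lemma frac_of_less_1: "set ds \<subseteq> {..<B} \<Longrightarrow> frac_of B ds < 1"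
proof (induction ds)
  case (Cons d ds)
  then have "(of_nat (d + 1) :: rat) \<le> of_nat B" by (subst of_nat_le_iff) auto
  then show ?case using Cons by (auto simp: divide_less_eq)
qed simp

lemma frac_of_append:
  "0 < B \<Longrightarrow> frac_of B (ds @ es) = frac_of B ds + frac_of B es / of_nat B ^ length ds"
  by (induction ds) (auto simp: field_simps)

lemma frac_of_pop: "0 < B \<Longrightarrow> of_nat B * frac_of B ds = of_nat (head_symbol ds) + frac_of B (tl ds)"
  by (cases ds) auto

text \<open>This supplies the natural number whose base \<open>B\<close> digits are a given
  string.\<close>

lemma frac_of_integral: "0 < B \<Longrightarrow> \<exists>p. frac_of B ds * of_nat B ^ length ds = of_nat p"
proof (induction ds)
  case (Cons d ds)
  then obtain p where p: "frac_of B ds * of_nat B ^ length ds = of_nat p" by auto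
  have "frac_of B (d # ds) * of_nat B ^ length (d # ds) =
      of_nat d * of_nat B ^ length ds + frac_of B ds * of_nat B ^ length ds"
    using Cons by (simp add: field_simps)
  then have "frac_of B (d # ds) * of_nat B ^ length (d # ds) = of_nat (d * B ^ length ds + p)"
    using p by simp
  then show ?case by blast
qed (auto intro: exI[of _ 0])

text \<open>Greedy expansion into j digits, most significant first. This is the order in which the
  system emits them, whereas \<open>binary\<close> recurses on the least significant digit.\<close>

fun bits :: "nat \<Rightarrow> nat \<Rightarrow> symbol list" where
  "bits 0 q = []"
| "bits (Suc j) q = (if 2 ^ j \<le> q then Digit1 # bits j (q - 2 ^ j) else Digit0 # bits j q)"

text \<open>Splitting off the last digit brings \<open>bits\<close> into the form of the recursion
  of \<open>binary\<close>.\<close>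

lemma bits_last:
  "q < 2 ^ Suc j \<Longrightarrow> bits (Suc j) q = bits j (q div 2) @ [if even q then Digit0 else Digit1]"
proof (induction j arbitrary: q)
  case 0
  then show ?case by (auto simp: less_2_cases_iff)
next
  case (Suc j)
  show ?case
  proof (cases "2 ^ Suc j \<le> q")
    case True
    have lt: "q - 2 ^ Suc j < 2 ^ Suc j" using Suc.prems True by simp
    have d: "(q - 2 ^ Suc j) div 2 = q div 2 - 2 ^ j" and e: "even (q - 2 ^ Suc j) = even q"
      using True by (auto simp: div_mult_self4 even_diff_nat)
    have "2 ^ j \<le> q div 2" using True by (simp add: less_eq_div_iff_mult_less_eq mult.commute)
    then show ?thesis using True Suc.IH[OF lt] d e by simp
  next
    case False
    then have "q < 2 ^ Suc j" by simp
    moreover have "\<not> 2 ^ j \<le> q div 2" using False by (simp add: less_eq_div_iff_mult_less_eq mult.commute)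
    ultimately show ?thesis using False Suc.IH[of q] by simp
  qed
qed

lemma bits_binary: "2 ^ j \<le> q \<Longrightarrow> q < 2 ^ Suc j \<Longrightarrow> bits (Suc j) q = binary q"
proof (induction j arbitrary: q)
  case 0
  then have "q = 1" by simp
  then show ?case by (simp add: binary.simps[of "Suc 0"])
next
  case (Suc j)
  have "(2::nat) \<le> 2 ^ Suc j" by simp
  then have "\<not> q < 2" using Suc.prems by linarith
  moreover have "bits (Suc j) (q div 2) = binary (q div 2)"
    using Suc.prems by (intro Suc.IH) (auto simp: less_eq_div_iff_mult_less_eq mult.commute)
  ultimately show ?case
    using bits_last[OF Suc.prems(2)] by (simp add: binary.simps[of q])
qed


section \<open>A system that runs a machine on its own description\<close>

text \<open>The eight coordinates are: 0 the time t; 1 its square; 2 the control location; 3 a power of two;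
  4 the number whose binary digits are still to be written; 5 and 7 the tape to the left and to the
  right of the head, read as fractions in base B; 6 the weight of the last digit of coordinate 7.
  Location 4 + q stands for state q of the machine.\<close>

locale self_application =
  fixes M :: turing_machine
  assumes wf: "wf_tm M"
begin

abbreviation B :: nat where "B \<equiv> tm_symbols M"

definition guard_sub :: "aff \<Rightarrow> comparison \<Rightarrow> aff \<Rightarrow> aff \<times> comparison" where
  "guard_sub a c b = (asub a b, c)"

text \<open>With m digits written, coordinate 6 is B^(-m). Adding the fraction of \<open>ds\<close>
  with this weight appends \<open>ds\<close> at the far end of the tape content.\<close>

definition writing :: "nat list \<Rightarrow> (nat \<Rightarrow> aff) \<Rightarrow> nat \<Rightarrow> aff" where
  "writing ds u = u(6 := ascale (1 / of_nat B ^ length ds) (avar 6),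
                    7 := aadd (avar 7) (ascale (frac_of B ds) (avar 6)))"

text \<open>The initial number is needed twice, for its base \<open>B\<close> digits and for its
  binary digits; the copy in coordinate 4 survives the divisions that follow.\<close>

definition copy_rule :: rule where
  "copy_rule = ([guard_sub (avar 2) EQ (aconst 0)], avar(2 := aconst 1, 4 := avar 7))"

text \<open>Repeated division by \<open>B\<close> until the value is below 1 turns the integer into
  a fraction with the same digits; coordinate 6 records the number of divisions as a power of
  1/B.\<close>

definition shift_rule :: rule where
  "shift_rule = ([guard_sub (avar 2) EQ (aconst 1), guard_sub (avar 7) GE (aconst 1)],
     avar(6 := ascale (1 / of_nat B) (avar 6), 7 := ascale (1 / of_nat B) (avar 7)))"

definition shifted_rule :: rule where
  "shifted_rule = ([guard_sub (avar 2) EQ (aconst 1), guard_sub (avar 7) LT (aconst 1)],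
     avar(2 := aconst 2))"

text \<open>Coordinate 3 climbs to the largest power of two that does not exceed coordinate 4, the
  weight of the leading binary digit.\<close>

definition double_rule :: rule where
  "double_rule = ([guard_sub (avar 2) EQ (aconst 2), guard_sub (avar 4) GE (ascale 2 (avar 3))],
     avar(3 := ascale 2 (avar 3)))"

definition doubled_rule :: rule where
  "doubled_rule = ([guard_sub (avar 2) EQ (aconst 2), guard_sub (avar 4) LT (ascale 2 (avar 3))],
     avar(2 := aconst 3))"

definition one_rule :: rule where
  "one_rule = ([guard_sub (avar 2) EQ (aconst 3), guard_sub (avar 3) GE (aconst 1),
      guard_sub (avar 4) GE (avar 3)],
     writing [tape_symbol Digit1] (avar(3 := ascale (1 / 2) (avar 3), 4 := asub (avar 4) (avar 3))))"

definition zero_rule :: rule where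
  "zero_rule = ([guard_sub (avar 2) EQ (aconst 3), guard_sub (avar 3) GE (aconst 1),
      guard_sub (avar 4) LT (avar 3)],
     writing [tape_symbol Digit0] (avar(3 := ascale (1 / 2) (avar 3))))"

text \<open>The last coordinate p of the initial point is presented as its binary digits, closed by a
  parenthesis, and the denominator 1; one more parenthesis ends the vector.\<close>

definition suffix :: "symbol list" where
  "suffix = [RParen, LParen, Digit1, RParen, RParen]"

text \<open>Coordinate 3 falls from 1 to 1/2 when the last binary digit is written; a value below 1
  thus marks the end of the digits.\<close>

definition suffix_rule :: rule where
  "suffix_rule = ([guard_sub (avar 2) EQ (aconst 3), guard_sub (avar 3) LT (aconst 1)],
     writing (map tape_symbol suffix) (avar(2 := aconst (of_nat (tm_start M) + 4))))"

text \<open>The rule for scanned symbol a and nearest left symbol b; a popped digit is the integer part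
  of B times the fraction.\<close>

definition tm_rule :: "nat \<Rightarrow> nat \<Rightarrow> nat \<Rightarrow> rule" where
  "tm_rule q a b =
    ([guard_sub (avar 2) EQ (aconst (of_nat q + 4)),
      guard_sub (ascale (of_nat B) (avar 7)) GE (aconst (of_nat a)),
      guard_sub (ascale (of_nat B) (avar 7)) LT (aconst (of_nat a + 1)),
      guard_sub (ascale (of_nat B) (avar 5)) GE (aconst (of_nat b)),
      guard_sub (ascale (of_nat B) (avar 5)) LT (aconst (of_nat b + 1))],
     case tm_delta M q a of (q', s, d) \<Rightarrow>
       let tail = asub (ascale (of_nat B) (avar 7)) (aconst (of_nat a));
           push = \<lambda>s u. ascale (1 / of_nat B) (aadd (aconst (of_nat s)) u) in
       case d of
         Stay \<Rightarrow> avar(2 := aconst (of_nat q' + 4), 7 := push s tail)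
       | MoveRight \<Rightarrow> avar(2 := aconst (of_nat q' + 4), 5 := push s (avar 5), 7 := tail)
       | MoveLeft \<Rightarrow> avar(2 := aconst (of_nat q' + 4),
           5 := asub (ascale (of_nat B) (avar 5)) (aconst (of_nat b)), 7 := push b (push s tail)))"

text \<open>The accepting and rejecting states get no rule, so the trajectory ends when the machine
  halts.\<close>

definition rules :: "rule list" where
  "rules = [copy_rule, shift_rule, shifted_rule, double_rule, doubled_rule,
      one_rule, zero_rule, suffix_rule] @
    [tm_rule q a b. q \<leftarrow> [0..<tm_states M], q \<noteq> tm_accept M \<and> q \<noteq> tm_reject M,
       a \<leftarrow> [0..<B], b \<leftarrow> [0..<B]]"

definition bad_rule :: rule where
  "bad_rule = ([guard_sub (avar 2) EQ (aconst (of_nat (tm_accept M) + 4))], avar)"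

text \<open>The number \<open>p\<close> enters only the last coordinate of the initial point, so all
  that is presented before its digits is the same for every \<open>p\<close>.\<close>

definition sys :: "nat \<Rightarrow> system" where
  "sys p = \<lparr>sys_dim = 8,
     sys_trans = (\<lambda>j k. if j = C_bad then [] else
       map (compile 8) (if k = C_init then rules else [bad_rule])),
     sys_start = vec_of_list [0, 0, 0, 1, 0, 0, 1, of_nat p]\<rparr>"

section \<open>Guards, well-formedness and presentation of the system\<close>

lemma rule_holds_iff:
  "rule_holds 8 copy_rule x \<longleftrightarrow> x $ 2 = 0"
  "rule_holds 8 shift_rule x \<longleftrightarrow> x $ 2 = 1 \<and> 1 \<le> x $ 7"
  "rule_holds 8 shifted_rule x \<longleftrightarrow> x $ 2 = 1 \<and> x $ 7 < 1"
  "rule_holds 8 double_rule x \<longleftrightarrow> x $ 2 = 2 \<and> 2 * x $ 3 \<le> x $ 4"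
  "rule_holds 8 doubled_rule x \<longleftrightarrow> x $ 2 = 2 \<and> x $ 4 < 2 * x $ 3"
  "rule_holds 8 one_rule x \<longleftrightarrow> x $ 2 = 3 \<and> 1 \<le> x $ 3 \<and> x $ 3 \<le> x $ 4"
  "rule_holds 8 zero_rule x \<longleftrightarrow> x $ 2 = 3 \<and> 1 \<le> x $ 3 \<and> x $ 4 < x $ 3"
  "rule_holds 8 suffix_rule x \<longleftrightarrow> x $ 2 = 3 \<and> x $ 3 < 1"
  "rule_holds 8 (tm_rule q a b) x \<longleftrightarrow> x $ 2 = of_nat q + 4 \<and>
     of_nat a \<le> of_nat B * x $ 7 \<and> of_nat B * x $ 7 < of_nat a + 1 \<and>
     of_nat b \<le> of_nat B * x $ 5 \<and> of_nat B * x $ 5 < of_nat b + 1"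
  "rule_holds 8 bad_rule x \<longleftrightarrow> x $ 2 = of_nat (tm_accept M) + 4"
  by ((auto simp: rule_holds_def guard_sub_def copy_rule_def shift_rule_def shifted_rule_def
      double_rule_def doubled_rule_def one_rule_def zero_rule_def suffix_rule_def tm_rule_def
      bad_rule_def; linarith)+)

lemma set_rules:
  "set rules = {copy_rule, shift_rule, shifted_rule, double_rule, doubled_rule,
      one_rule, zero_rule, suffix_rule} \<union>
    {tm_rule q a b |q a b. q < tm_states M \<and> q \<noteq> tm_accept M \<and> q \<noteq> tm_reject M \<and> a < B \<and> b < B}"
proof -
  have "set [tm_rule q a b. q \<leftarrow> [0..<tm_states M], q \<noteq> tm_accept M \<and> q \<noteq> tm_reject M,
       a \<leftarrow> [0..<B], b \<leftarrow> [0..<B]] =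
    {tm_rule q a b |q a b. q < tm_states M \<and> q \<noteq> tm_accept M \<and> q \<noteq> tm_reject M \<and> a < B \<and> b < B}"
    by fastforce
  then show ?thesis unfolding rules_def set_append by simp
qed

lemma wf_system_sys: "wf_system (sys p)"
proof -
  have "wf_transition 8 []" by (simp add: wf_transition_def)
  moreover have "vec_of_list [0, 0, 0, 1, 0, 0, 1, of_nat p :: rat] \<in> carrier_vec 8"
    by (rule carrier_vecI) simp
  ultimately show ?thesis by (simp add: wf_system_def sys_def wf_transition_compile)
qed

lemma sys_start_index:
  "i < 8 \<Longrightarrow> sys_start (sys p) $ i = [0, 0, 0, 1, 0, 0, 1, of_nat p] ! i"
  by (simp add: sys_def vec_of_list_index del: vec_of_list_Cons)

text \<open>The string \<open>w\<close> is fixed before \<open>p\<close>, so \<open>p\<close> may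
  later be chosen to encode \<open>w\<close> without circularity. The parenthesis that opens the
  numerator of the last coordinate belongs to \<open>w\<close>.\<close>

lemma enc_system_sys:
  obtains w where "w \<noteq> []" "\<And>p. enc_system (sys p) = w @ binary p @ suffix"
proof -
  have rat: "enc_rat (of_nat p) = LParen # binary p @ [RParen, LParen, Digit1, RParen]" for p
    by (simp add: enc_rat_def enc_int_def enc_nat_def binary.simps[of "Suc 0"])
  show thesis
    by (rule that[of "enc_nat 8 @ enc_transition (map (compile 8) rules) @
        enc_transition (map (compile 8) [bad_rule]) @ enc_transition [] @ enc_transition [] @
        LParen # concat (map enc_rat [0, 0, 0, 1, 0, 0, 1]) @ [LParen]"])
      (simp_all add: enc_system_def sys_def enc_vec_def enc_list_def list_vec rat suffix_def)
qed

abbreviation R :: "(rat vec \<times> rat vec) set" where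
  "R \<equiv> transition_rel 8 (map (compile 8) rules)"

lemma B_gt: "5 < B"
proof -
  have "tape_symbol RParen < B" using wf unfolding wf_tm_def by blast
  then show ?thesis by simp
qed

section \<open>Phases that write the presentation onto the tape\<close>

text \<open>The time stays unspecified apart from the parabola equation, so the phases can be
  composed without counting steps.\<close>

definition state :: "rat vec \<Rightarrow> rat \<Rightarrow> rat \<Rightarrow> rat \<Rightarrow> rat \<Rightarrow> rat \<Rightarrow> rat \<Rightarrow> bool" where
  "state x c h q l e r \<longleftrightarrow> dim_vec x = 8 \<and> x $ 1 = (x $ 0)\<^sup>2 \<and>
     x $ 2 = c \<and> x $ 3 = h \<and> x $ 4 = q \<and> x $ 5 = l \<and> x $ 6 = e \<and> x $ 7 = r"

lemma step_state:
  assumes x: "state x c h q l e r" and u: "u \<in> set rules" "rule_holds 8 u x"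
    and eqs: "c' = aff_eval 8 (snd u 2) x" "h' = aff_eval 8 (snd u 3) x"
      "q' = aff_eval 8 (snd u 4) x" "l' = aff_eval 8 (snd u 5) x"
      "e' = aff_eval 8 (snd u 6) x" "r' = aff_eval 8 (snd u 7) x"
  shows "\<exists>y. (x, y) \<in> R \<and> state y c' h' q' l' e' r'"
proof (intro exI conjI)
  show "(x, rule_apply 8 u x) \<in> R"
    using x u by (auto simp: transition_rel_compile state_def)
  have "rule_apply 8 u x $ 1 = (rule_apply 8 u x $ 0)\<^sup>2"
    using x by (simp add: rule_apply_clock[of 8, simplified] state_def power2_eq_square algebra_simps)
  then show "state (rule_apply 8 u x) c' h' q' l' e' r'"
    by (simp add: state_def eqs rule_apply_def ticking_def)
qed

text \<open>The first assumption says that the leading digit is nonzero. Hence the value is at least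
  1 as long as a factor \<open>B\<close> is left and drops below 1 exactly when none is, so the loop
  stops at the right place.\<close>

lemma shift_phase:
  assumes "1 \<le> of_nat B * frac_of B ds" "frac_of B ds < 1"
    and "state x 1 h q l e (frac_of B ds * of_nat B ^ k)"
  shows "\<exists>y. (x, y) \<in> R\<^sup>* \<and> state y 2 h q l (e / of_nat B ^ k) (frac_of B ds)"
  using assms(3)
proof (induction k arbitrary: x e)
  case 0
  then have x: "x $ 2 = 1" "x $ 3 = h" "x $ 4 = q" "x $ 5 = l" "x $ 6 = e" "x $ 7 = frac_of B ds"
    by (auto simp: state_def)
  have "\<exists>y. (x, y) \<in> R \<and> state y 2 h q l (e / of_nat B ^ 0) (frac_of B ds)"
    by (rule step_state[OF 0, of shifted_rule])
      (use assms(2) in \<open>simp_all add: set_rules shifted_rule_def rule_holds_def guard_sub_def x\<close>)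
  then show ?case by blast
next
  case (Suc k)
  then have x: "x $ 2 = 1" "x $ 3 = h" "x $ 4 = q" "x $ 5 = l" "x $ 6 = e"
    "x $ 7 = frac_of B ds * of_nat B ^ Suc k"
    by (auto simp: state_def)
  have "1 * 1 \<le> of_nat B * frac_of B ds * of_nat B ^ k"
    using assms(1) B_gt by (intro mult_mono one_le_power) auto
  then have ge: "1 \<le> x $ 7" by (simp add: x mult.commute mult.left_commute)
  have "\<exists>y. (x, y) \<in> R \<and> state y 1 h q l (e / of_nat B) (frac_of B ds * of_nat B ^ k)"
    by (rule step_state[OF Suc.prems, of shift_rule])
      (use ge B_gt in \<open>simp_all add: set_rules shift_rule_def rule_holds_def guard_sub_def x\<close>)
  then obtain y where y: "(x, y) \<in> R" "state y 1 h q l (e / of_nat B) (frac_of B ds * of_nat B ^ k)"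
    by blast
  from Suc.IH[OF y(2)] y(1) show ?case by (auto intro: converse_rtrancl_into_rtrancl)
qed

lemma double_phase:
  assumes "2 ^ i \<le> p" "state x 2 (2 ^ i) (of_nat p) l e r"
  shows "\<exists>y j. 2 ^ j \<le> p \<and> p < 2 ^ Suc j \<and> (x, y) \<in> R\<^sup>* \<and> state y 3 (2 ^ j) (of_nat p) l e r"
  using assms
proof (induction "p - 2 ^ i" arbitrary: i x rule: less_induct)
  case less
  have x: "x $ 2 = 2" "x $ 3 = 2 ^ i" "x $ 4 = of_nat p" "x $ 5 = l" "x $ 6 = e" "x $ 7 = r"
    using less.prems by (auto simp: state_def)
  have cmp: "(2 :: rat) * 2 ^ i \<le> of_nat p \<longleftrightarrow> 2 * 2 ^ i \<le> p" for p
    by (metis of_nat_le_iff of_nat_mult of_nat_numeral of_nat_power)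
  show ?case
  proof (cases "2 * 2 ^ i \<le> p")
    case True
    have "\<exists>y. (x, y) \<in> R \<and> state y 2 (2 ^ Suc i) (of_nat p) l e r"
      by (rule step_state[OF less.prems(2), of double_rule])
        (use True in \<open>simp_all add: set_rules double_rule_def rule_holds_def guard_sub_def x cmp\<close>)
    then obtain y where y: "(x, y) \<in> R" "state y 2 (2 ^ Suc i) (of_nat p) l e r" by blast
    have "(0 :: nat) < 2 ^ i" by simp
    then have "p - 2 ^ Suc i < p - 2 ^ i"
      using True unfolding power_Suc by linarith
    with less.hyps[of "Suc i" y] True y show ?thesis
      by (auto intro: converse_rtrancl_into_rtrancl)
  next
    case False
    have "\<exists>y. (x, y) \<in> R \<and> state y 3 (2 ^ i) (of_nat p) l e r"
      by (rule step_state[OF less.prems(2), of doubled_rule])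
        (use False in \<open>simp_all add: set_rules doubled_rule_def rule_holds_def guard_sub_def x cmp
          flip: not_le\<close>)
    moreover have "p < 2 ^ Suc i" using False by simp
    ultimately show ?thesis using less.prems(1) by blast
  qed
qed

text \<open>Coordinate 3 is written as 2^j / 2 so that the case j = 0 gives 1/2, its value on
  leaving the loop.\<close>

lemma bits_phase:
  assumes "q < 2 ^ j"
    and "state x 3 (2 ^ j / 2) (of_nat q) l (1 / of_nat B ^ length ds) (frac_of B ds)"
  shows "\<exists>y. (x, y) \<in> R\<^sup>* \<and> (let es = ds @ map tape_symbol (bits j q) in
    state y 3 (1 / 2) 0 l (1 / of_nat B ^ length es) (frac_of B es))"
  using assms
proof (induction j arbitrary: q x ds)
  case 0
  then show ?case by (auto simp: Let_def)
next
  case (Suc j)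
  have x: "x $ 2 = 3" "x $ 3 = 2 ^ j" "x $ 4 = of_nat q" "x $ 5 = l"
    "x $ 6 = 1 / of_nat B ^ length ds" "x $ 7 = frac_of B ds"
    using Suc.prems by (auto simp: state_def)
  have B: "0 < B" using B_gt by simp
  have cmp: "(2 :: rat) ^ j \<le> of_nat q \<longleftrightarrow> 2 ^ j \<le> q"
    by (metis of_nat_le_iff of_nat_numeral of_nat_power)
  show ?case
  proof (cases "2 ^ j \<le> q")
    case True
    have q: "q - 2 ^ j < 2 ^ j" using Suc.prems(1) True by simp
    let ?es = "ds @ [tape_symbol Digit1]"
    have "\<exists>y. (x, y) \<in> R \<and>
        state y 3 (2 ^ j / 2) (of_nat (q - 2 ^ j)) l (1 / of_nat B ^ length ?es) (frac_of B ?es)"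
      by (rule step_state[OF Suc.prems(2), of one_rule])
        (use True in \<open>simp_all add: set_rules one_rule_def rule_holds_def guard_sub_def x cmp
          writing_def frac_of_append[OF B]\<close>)
    then obtain y where "(x, y) \<in> R"
      "state y 3 (2 ^ j / 2) (of_nat (q - 2 ^ j)) l (1 / of_nat B ^ length ?es) (frac_of B ?es)"
      by blast
    with Suc.IH[OF q, of y ?es] True show ?thesis
      by (auto simp: Let_def intro: converse_rtrancl_into_rtrancl)
  next
    case False
    then have q: "q < 2 ^ j" by simp
    let ?es = "ds @ [tape_symbol Digit0]"
    have "\<exists>y. (x, y) \<in> R \<and>
        state y 3 (2 ^ j / 2) (of_nat q) l (1 / of_nat B ^ length ?es) (frac_of B ?es)"
      by (rule step_state[OF Suc.prems(2), of zero_rule])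
        (use False in \<open>simp_all add: set_rules zero_rule_def rule_holds_def guard_sub_def x cmp
          writing_def frac_of_append[OF B] flip: not_le\<close>)
    then obtain y where "(x, y) \<in> R"
      "state y 3 (2 ^ j / 2) (of_nat q) l (1 / of_nat B ^ length ?es) (frac_of B ?es)"
      by blast
    with Suc.IH[OF q, of y ?es] False show ?thesis
      by (auto simp: Let_def intro: converse_rtrancl_into_rtrancl)
  qed
qed

lemma suffix_phase:
  assumes "state x 3 (1 / 2) q l (1 / of_nat B ^ length ds) (frac_of B ds)"
  shows "\<exists>y e. (x, y) \<in> R \<and> state y (of_nat (tm_start M) + 4) (1 / 2) q l e
    (frac_of B (ds @ map tape_symbol suffix))"
proof -
  have x: "x $ 2 = 3" "x $ 3 = 1 / 2" "x $ 4 = q" "x $ 5 = l"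
    "x $ 6 = 1 / of_nat B ^ length ds" "x $ 7 = frac_of B ds"
    using assms by (auto simp: state_def)
  have B: "0 < B" using B_gt by simp
  let ?e = "aff_eval 8 (snd suffix_rule 6) x"
  have "\<exists>y. (x, y) \<in> R \<and> state y (of_nat (tm_start M) + 4) (1 / 2) q l ?e
    (frac_of B (ds @ map tape_symbol suffix))"
    by (rule step_state[OF assms, of suffix_rule])
      (simp_all add: set_rules suffix_rule_def rule_holds_def guard_sub_def x
          writing_def frac_of_append[OF B])
  then show ?thesis by blast
qed

lemma tape_symbol_bounds: "0 < tape_symbol a" "tape_symbol a < B"
  using B_gt by (cases a; simp)+

lemma reach_tm_start:
  assumes "w \<noteq> []" and p: "of_nat p = frac_of B (map tape_symbol w) * of_nat B ^ length w"
  shows "\<exists>y h q e. (sys_start (sys p), y) \<in> R\<^sup>* \<and> state y (of_nat (tm_start M) + 4) h q 0 e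
    (frac_of B (map tape_symbol (w @ binary p @ suffix)))"
proof -
  let ?w = "map tape_symbol w"
  have B: "0 < B" using B_gt by simp
  have lt: "frac_of B ?w < 1"
    by (rule frac_of_less_1) (auto simp: tape_symbol_bounds)
  obtain a v where w: "w = a # v" using assms(1) by (cases w) auto
  \<comment> \<open>Input symbols are never the blank 0, so the leading digit is nonzero as the
    division loop requires.\<close>
  have "(1 :: rat) \<le> of_nat (tape_symbol a)" using tape_symbol_bounds(1)[of a] by simp
  then have ge: "1 \<le> of_nat B * frac_of B ?w"
    using frac_of_nonneg[of B "map tape_symbol v"] B by (simp add: w add_increasing2)
  then have "frac_of B ?w \<noteq> 0" by auto
  then have "frac_of B ?w > 0" using frac_of_nonneg[of B ?w] by linarith
  then have "(of_nat p :: rat) > 0" using B unfolding p by simp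
  then have p_ge: "2 ^ 0 \<le> p" by simp
  let ?x = "sys_start (sys p)"
  have x: "?x $ 2 = 0" "?x $ 3 = 1" "?x $ 4 = 0" "?x $ 5 = 0" "?x $ 6 = 1" "?x $ 7 = of_nat p"
    by (simp_all add: sys_start_index)
  have "dim_vec ?x = 8" by (simp add: sys_def)
  then have "state ?x 0 1 0 0 1 (of_nat p)"
    by (simp add: state_def sys_start_index)
  then have "\<exists>y. (?x, y) \<in> R \<and> state y 1 1 (of_nat p) 0 1 (of_nat p)"
    by (rule step_state[where u = copy_rule])
      (simp_all add: set_rules copy_rule_def rule_holds_def guard_sub_def x)
  then obtain x1 where x1: "(?x, x1) \<in> R" "state x1 1 1 (of_nat p) 0 1 (of_nat p)" by blast
  obtain x2 where x2: "(x1, x2) \<in> R\<^sup>*"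
    "state x2 2 (2 ^ 0) (of_nat p) 0 (1 / of_nat B ^ length ?w) (frac_of B ?w)"
    using shift_phase[OF ge lt, of x1 1 "of_nat p" 0 1 "length w"] x1(2) p by auto
  obtain x3 j where x3: "2 ^ j \<le> p" "p < 2 ^ Suc j" "(x2, x3) \<in> R\<^sup>*"
    "state x3 3 (2 ^ j) (of_nat p) 0 (1 / of_nat B ^ length ?w) (frac_of B ?w)"
    using double_phase[OF p_ge x2(2)] by blast
  have "state x3 3 (2 ^ Suc j / 2) (of_nat p) 0 (1 / of_nat B ^ length ?w) (frac_of B ?w)"
    using x3(4) by simp
  from bits_phase[OF x3(2) this] obtain x4 where x4: "(x3, x4) \<in> R\<^sup>*"
    "state x4 3 (1 / 2) 0 0 (1 / of_nat B ^ length (?w @ map tape_symbol (binary p)))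
       (frac_of B (?w @ map tape_symbol (binary p)))"
    unfolding bits_binary[OF x3(1,2)] Let_def by blast
  obtain x5 e where x5: "(x4, x5) \<in> R" "state x5 (of_nat (tm_start M) + 4) (1 / 2) 0 0 e
       (frac_of B ((?w @ map tape_symbol (binary p)) @ map tape_symbol suffix))"
    using suffix_phase[OF x4(2)] by blast
  have "(?x, x5) \<in> R\<^sup>*" using x1(1) x2(1) x3(3) x4(1) x5(1) 
    by (meson rtrancl.rtrancl_into_rtrancl converse_rtrancl_into_rtrancl rtrancl_trans)
  then show ?thesis using x5(2) by auto
qed

section \<open>Step-by-step simulation of the machine\<close>

text \<open>The values \<open>h\<close>, \<open>v\<close> and \<open>e\<close> are remnants of the
  writing phases; the machine rules leave them alone.\<close>

fun represents :: "rat vec \<Rightarrow> config \<Rightarrow> bool" where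
  "represents x (q, ls, rs) \<longleftrightarrow> q < tm_states M \<and> set ls \<subseteq> {..<B} \<and> set rs \<subseteq> {..<B} \<and>
     (\<exists>h v e. state x (of_nat q + 4) h v (frac_of B ls) e (frac_of B rs))"

lemma head_symbol_less: "set ds \<subseteq> {..<B} \<Longrightarrow> head_symbol ds < B"
  using B_gt by (cases ds) auto

lemma set_tl_subset: "set ds \<subseteq> A \<Longrightarrow> set (tl ds) \<subseteq> A"
  by (cases ds) auto

text \<open>Multiplying a tape fraction by \<open>B\<close> gives the nearest symbol plus the
  fraction of the rest, which lies in [0, 1). The guards therefore hold for the two symbols next to
  the head, and subtracting a symbol pops it.\<close>

lemma step_represents:
  assumes "represents x (q, ls, rs)" and q: "q \<noteq> tm_accept M" "q \<noteq> tm_reject M"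
  shows "\<exists>y. (x, y) \<in> R \<and> represents y (tm_step M (q, ls, rs))"
proof -
  have B: "0 < B" using B_gt by simp
  have qs: "q < tm_states M" and ls: "set ls \<subseteq> {..<B}" and rs: "set rs \<subseteq> {..<B}"
    using assms(1) by auto
  obtain h v e where st: "state x (of_nat q + 4) h v (frac_of B ls) e (frac_of B rs)"
    using assms(1) by auto
  then have x: "x $ 2 = of_nat q + 4" "x $ 3 = h" "x $ 4 = v" "x $ 5 = frac_of B ls"
    "x $ 6 = e" "x $ 7 = frac_of B rs"
    by (auto simp: state_def)
  define a b where "a = head_symbol rs" and "b = head_symbol ls"
  have a: "a < B" and b: "b < B" using ls rs by (auto simp: a_def b_def head_symbol_less)
  have popR: "of_nat B * frac_of B rs = of_nat a + frac_of B (tl rs)"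
    and popL: "of_nat B * frac_of B ls = of_nat b + frac_of B (tl ls)"
    using frac_of_pop[OF B] by (auto simp: a_def b_def)
  have tls: "set (tl ls) \<subseteq> {..<B}" "set (tl rs) \<subseteq> {..<B}"
    using ls rs by (auto dest: set_tl_subset)
  have rule: "tm_rule q a b \<in> set rules" using qs q a b unfolding set_rules by blast
  have holds: "rule_holds 8 (tm_rule q a b) x"
    using frac_of_less_1[OF tls(1)] frac_of_less_1[OF tls(2)]
      frac_of_nonneg[of B "tl ls"] frac_of_nonneg[of B "tl rs"]
    by (simp add: rule_holds_iff x popR popL)
  obtain q' s d where del: "tm_delta M q a = (q', s, d)" by (cases "tm_delta M q a") auto
  then have q': "q' < tm_states M" "s < B"
    using wf qs a unfolding wf_tm_def by (metis (mono_tags, lifting) case_prod_conv)+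
  obtain ls' rs' where mv: "move_head d (ls, s # tl rs) = (ls', rs')"
    by (cases "move_head d (ls, s # tl rs)") auto
  have "\<exists>y. (x, y) \<in> R \<and> state y (of_nat q' + 4) h v (frac_of B ls') e (frac_of B rs')"
    by (rule step_state[OF st rule holds]; cases d)
      (use mv in \<open>auto simp: tm_rule_def del x popR popL b_def[symmetric]\<close>)
  moreover have "set ls' \<subseteq> {..<B}" "set rs' \<subseteq> {..<B}"
    using mv ls rs tls q'(2) b by (cases d; auto simp: b_def)+
  ultimately show ?thesis using q q' by (auto simp: del a_def[symmetric] mv)
qed

text \<open>Halted configurations are fixed points of \<open>tm_step\<close>, so after halting the
  same point goes on representing the configuration.\<close>

lemma run_represents:
  assumes "(z, x) \<in> R\<^sup>*" "represents x cfg"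
  shows "\<exists>y. (z, y) \<in> R\<^sup>* \<and> represents y ((tm_step M ^^ t) cfg)"
proof (induction t)
  case 0
  then show ?case using assms by auto
next
  case (Suc t)
  then obtain y where y: "(z, y) \<in> R\<^sup>*" "represents y ((tm_step M ^^ t) cfg)" by blast
  obtain q ls rs where c: "(tm_step M ^^ t) cfg = (q, ls, rs)" by (metis prod_cases3)
  show ?case
  proof (cases "q = tm_accept M \<or> q = tm_reject M")
    case True
    then have "tm_step M (q, ls, rs) = (q, ls, rs)" by simp
    then show ?thesis using y c by auto
  next
    case False
    then obtain y' where "(y, y') \<in> R" "represents y' (tm_step M (q, ls, rs))"
      using step_represents y(2) c by metis
    then show ?thesis using y(1) c by (auto intro: rtrancl_into_rtrancl simp del: tm_step.simps)
  qed
qed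

section \<open>Determinism and halting of the system\<close>

text \<open>The one rule that can hold at \<open>x\<close>, computed from \<open>x\<close>; this
  makes \<open>R\<close> single-valued. The floors recover the state and the symbols from the
  coordinates.\<close>

definition enabled_rule :: "rat vec \<Rightarrow> rule" where
  "enabled_rule x =
    (if x $ 2 = 0 then copy_rule
     else if x $ 2 = 1 then if 1 \<le> x $ 7 then shift_rule else shifted_rule
     else if x $ 2 = 2 then if 2 * x $ 3 \<le> x $ 4 then double_rule else doubled_rule
     else if x $ 2 = 3 then
       if x $ 3 < 1 then suffix_rule else if x $ 3 \<le> x $ 4 then one_rule else zero_rule
     else tm_rule (nat \<lfloor>x $ 2\<rfloor> - 4) (nat \<lfloor>of_nat B * x $ 7\<rfloor>) (nat \<lfloor>of_nat B * x $ 5\<rfloor>))"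

lemma rule_holds_unique:
  assumes "u \<in> set rules" "rule_holds 8 u x"
  shows "u = enabled_rule x"
proof -
  consider "u \<in> {copy_rule, shift_rule, shifted_rule, double_rule, doubled_rule,
      one_rule, zero_rule, suffix_rule}"
    | q a b where "u = tm_rule q a b"
    using assms(1) by (auto simp: set_rules)
  then show ?thesis
  proof cases
    case 1
    then show ?thesis
      using assms(2) by (elim insertE emptyE) (simp_all add: enabled_rule_def rule_holds_iff)
  next
    case (2 q a b)
    have h: "x $ 2 = of_nat (q + 4)" "\<lfloor>of_nat B * x $ 7\<rfloor> = int a" "\<lfloor>of_nat B * x $ 5\<rfloor> = int b"
      using assms(2) by (simp_all add: 2 rule_holds_iff floor_eq_iff)
    have "x $ 2 \<ge> 4" unfolding h(1) by simp
    moreover have "nat \<lfloor>x $ 2\<rfloor> = q + 4" unfolding h(1) floor_of_nat by simp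
    ultimately show ?thesis using h(2,3) by (simp add: enabled_rule_def 2)
  qed
qed

lemma single_valued_R: "single_valued R"
  unfolding single_valued_def transition_rel_compile[of 8, simplified]
  using rule_holds_unique by metis

text \<open>Serves twice: the system stops at the rejecting location, and no point with a successor
  sits at the accepting location, where the bad rule applies.\<close>

lemma Domain_R:
  assumes "x \<in> Domain R" "q = tm_accept M \<or> q = tm_reject M"
  shows "x $ 2 \<noteq> of_nat q + 4"
proof
  assume xq: "x $ 2 = of_nat q + 4"
  obtain u where u: "u \<in> set rules" "rule_holds 8 u x"
    using assms(1) by (auto simp: transition_rel_compile)
  have ge: "x $ 2 \<ge> 4" using xq by simp
  consider "u \<in> {copy_rule, shift_rule, shifted_rule, double_rule, doubled_rule,
      one_rule, zero_rule, suffix_rule}"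
    | q' a b where "u = tm_rule q' a b" "q' \<noteq> tm_accept M" "q' \<noteq> tm_reject M"
    using u(1) by (auto simp: set_rules)
  then show False
  proof cases
    case 1
    then show ?thesis
      using u(2) ge by (elim insertE emptyE) (simp_all add: rule_holds_iff)
  next
    case (2 q' a b)
    then have "x $ 2 = of_nat q' + 4"
      using u(2) by (simp add: rule_holds_iff)
    then show ?thesis using xq 2 assms(2) by auto
  qed
qed

lemma bad_rule_iff:
  "x \<in> Domain (transition_rel 8 (map (compile 8) [bad_rule])) \<longleftrightarrow>
    dim_vec x = 8 \<and> x $ 1 = (x $ 0)\<^sup>2 \<and> x $ 2 = of_nat (tm_accept M) + 4"
  by (auto simp: Domain_iff transition_rel_compile rule_holds_iff simp del: list.map)

section \<open>The diagonal argument\<close>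

lemma not_decides:
  "\<exists>S. wf_system S \<and> \<not> (if has_polyhedral_separating_invariant S
     then tm_accepts M (enc_system S) else tm_rejects M (enc_system S))"
proof -
  obtain w where w: "w \<noteq> []" and enc: "\<And>p. enc_system (sys p) = w @ binary p @ suffix"
    using enc_system_sys by blast
  \<comment> \<open>Self-reference: the base \<open>B\<close> digits of \<open>p\<close> spell the
    part \<open>w\<close> of the presentation that comes before the binary digits of
    \<open>p\<close>.\<close>
  obtain p where p: "frac_of B (map tape_symbol w) * of_nat B ^ length w = of_nat p"
    using frac_of_integral[of B "map tape_symbol w"] B_gt by auto
  let ?S = "sys p"
  obtain y h v e where y: "(sys_start ?S, y) \<in> R\<^sup>*" "state y (of_nat (tm_start M) + 4) h v 0 e
      (frac_of B (map tape_symbol (enc_system ?S)))"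
    using reach_tm_start[OF w p[symmetric]] unfolding enc by blast
  have "represents y (tm_start M, [], map tape_symbol (enc_system ?S))"
    using y(2) wf by (auto simp: wf_tm_def tape_symbol_bounds)
  from run_represents[OF y(1) this]
  have run: "\<exists>x. (sys_start ?S, x) \<in> R\<^sup>* \<and> represents x (tm_run M (enc_system ?S) t)" for t
    unfolding tm_run_def .
  have reach: "\<exists>x h v l e r. (sys_start ?S, x) \<in> R\<^sup>* \<and> state x (of_nat q + 4) h v l e r"
    if "fst (tm_run M (enc_system ?S) t) = q" for q t
    using run[of t] that by (cases "tm_run M (enc_system ?S) t") fastforce
  have "\<not> has_polyhedral_separating_invariant ?S" if acc: "tm_accepts M (enc_system ?S)"
  proof -
    obtain x h v l e r where x: "(sys_start ?S, x) \<in> R\<^sup>*"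
      "state x (of_nat (tm_accept M) + 4) h v l e r"
      using acc reach unfolding tm_accepts_def by blast
    then obtain z where "(x, z) \<in> transition_rel 8 (map (compile 8) [bad_rule])"
      using bad_rule_iff[of x] by (auto simp: state_def)
    then show ?thesis
      using x(1) by (intro bad_no_invariant[of ?S x z]) (simp_all add: sys_def)
  qed
  moreover have "has_polyhedral_separating_invariant ?S" if rej: "tm_rejects M (enc_system ?S)"
  proof -
    obtain x h v l e r where x: "(sys_start ?S, x) \<in> R\<^sup>*"
      "state x (of_nat (tm_reject M) + 4) h v l e r"
      using rej reach unfolding tm_rejects_def by blast
    have x2: "x $ 2 = of_nat (tm_reject M) + 4" using x(2) by (simp add: state_def)
    have ne: "tm_accept M \<noteq> tm_reject M" using wf by (simp add: wf_tm_def)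
    show ?thesis
    proof (rule halting_invariant[of ?S R rules "[bad_rule]" x])
      show "x \<notin> Domain R" using Domain_R x2 by blast
      \<comment> \<open>The bad rule fires only at the accepting location: \<open>x\<close> is at
        the rejecting one, and points in the domain of \<open>R\<close> are at neither.\<close>
      show "x' \<notin> Domain (transition_rel (sys_dim ?S) (map (compile (sys_dim ?S)) [bad_rule]))"
        if "x' = x \<or> x' \<in> Domain R" for x'
        using that Domain_R[of x'] x2 ne bad_rule_iff[of x'] by (auto simp: sys_def)
      show "sys_start ?S \<in> carrier_vec (sys_dim ?S)"
        using wf_system_sys by (auto simp: wf_system_def)
      show "sys_start ?S $ 0 = 0" "sys_start ?S $ 1 = 0" by (simp_all add: sys_start_index)
    qed (use x(1) single_valued_R in \<open>simp_all add: sys_def\<close>)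
  qed
  \<comment> \<open>If the machine neither accepts nor rejects, it fails whichever answer is
    correct.\<close>
  ultimately show ?thesis using wf_system_sys by metis
qed

end

theorem mainTheorem3:
  shows "\<not> decidable enc_system {S. wf_system S} has_polyhedral_separating_invariant"
proof
  assume "decidable enc_system {S. wf_system S} has_polyhedral_separating_invariant"
  then obtain M where M: "wf_tm M" and dec: "\<And>S. wf_system S \<Longrightarrow>
      if has_polyhedral_separating_invariant S
      then tm_accepts M (enc_system S) else tm_rejects M (enc_system S)"
    unfolding decidable_def by auto
  from M interpret self_application M by unfold_locales
  show False using not_decides dec by metis
qed

end
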